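(* Let $f:\mathbb{R}^n\to\mathbb{R}$ and $\mathbf{D}$ be as defined in the context. A point $\mathbf{y}\in\mathbb{R}^n$ is a global minimizer of $f$ over $\mathbb{R}^n$ if and only if $\nabla f(\mathbf{y})=\mathbf{0}$ and $\mathbf{y}^T\mathbf{y}\ge D_{11}$. Moreover, if $\nabla f(\mathbf{y})=\mathbf{0}$ and $\mathbf{y}^T\mathbf{y}>D_{11}$, then $\mathbf{y}$ is the unique global minimizer of $f$.
   Context: Setting. Let $n,m\ge 1$, let $\mathbf{s}_1,\dots,\mathbf{s}_m\in\mathbb{R}^n$ (senders), $d_1,\dots,d_m\in\mathbb{R}$ (distance measurements), and let $\mathbf{W}=(w_{ij})\in\mathbb{R}^{m\times m}$ be symmetric positive definite. Assume (normalization) that $\sum_{i,j} w_{ij}=1$ and $\sum_{i,j} w_{ij}\mathbf{s}_i=\mathbf{0}$. Define $h:\mathbb{R}^n\to\mathbb{R}$ by $$h(\mathbf{x})=\frac14\sum_{i=1}^m\sum_{j=1}^m w_{ij}\,(\|\mathbf{x}-\mathbf{s}_i\|^2-d_i^2)(\|\mathbf{x}-\mathbf{s}_j\|^2-d_j^2).$$ Then $\nabla h(\mathbf{x})=(\mathbf{x}^T\mathbf{x})\mathbf{x}-\mathbf{A}\mathbf{x}+\mathbf{g}$, where $$\mathbf{A}=-\sum_{i,j}w_{ij}\left(2\mathbf{s}_j\mathbf{s}_i^T+(\mathbf{s}_i^T\mathbf{s}_i-d_i^2)\mathbf{I}\right),\qquad \mathbf{g}=-\sum_{i,j}w_{ij}(\mathbf{s}_i^T\mathbf{s}_i-d_i^2)\mathbf{s}_j,$$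 and $\mathbf{A}$ is real symmetric. Let $\mathbf{Q}$ be an orthogonal matrix such that $\mathbf{D}=\mathbf{Q}^T\mathbf{A}\mathbf{Q}$ is diagonal with $D_{11}\ge D_{22}\ge\dots\ge D_{nn}$, and let $\mathbf{b}=\mathbf{Q}^T\mathbf{g}$. Define $f(\mathbf{y})=h(\mathbf{Q}\mathbf{y})$ for $\mathbf{y}\in\mathbb{R}^n$, so that $$\nabla f(\mathbf{y})=(\mathbf{y}^T\mathbf{y})\mathbf{y}-\mathbf{D}\mathbf{y}+\mathbf{b}.$$ *)

theory Defs
  imports "HOL-Analysis.Analysis"
begin

definition positive_definite :: "real^'m^'m \<Rightarrow> bool" where
  "positive_definite W \<longleftrightarrow> transpose W = W \<and> (\<forall>v. v \<noteq> 0 \<longrightarrow> v \<bullet> (W *v v) > 0)"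

definition outer_product :: "real^'n \<Rightarrow> real^'n \<Rightarrow> real^'n^'n" where
  "outer_product u v = (\<chi> k l. u $ k * v $ l)"

definition localization_objective ::
    "real^'m^'m \<Rightarrow> ('m \<Rightarrow> real^'n) \<Rightarrow> ('m \<Rightarrow> real) \<Rightarrow> real^'n \<Rightarrow> real" where
  "localization_objective W s d x =
     (1/4) * (\<Sum>i\<in>UNIV. \<Sum>j\<in>UNIV. W $ i $ j *
        ((norm (x - s i))\<^sup>2 - (d i)\<^sup>2) * ((norm (x - s j))\<^sup>2 - (d j)\<^sup>2))"

definition localization_matrix ::
    "real^'m^'m \<Rightarrow> ('m \<Rightarrow> real^'n) \<Rightarrow> ('m \<Rightarrow> real) \<Rightarrow> real^'n^'n" where
  "localization_matrix W s d =
     - (\<Sum>i\<in>UNIV. \<Sum>j\<in>UNIV. W $ i $ j *\<^sub>R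
          (2 *\<^sub>R outer_product (s j) (s i) + (s i \<bullet> s i - (d i)\<^sup>2) *\<^sub>R mat 1))"

definition diagonal_matrix :: "real^'n^'n \<Rightarrow> bool" where
  "diagonal_matrix D \<longleftrightarrow> (\<forall>i j. i \<noteq> j \<longrightarrow> D $ i $ j = 0)"

text \<open>
  The coordinates are indexed by an arbitrary finite linearly ordered type, so that the
  diagonal entries can be listed in decreasing order. The index 1 is the least element.
\<close>

definition first_index :: "'n::{finite,linorder}" where
  "first_index = Min UNIV"

definition decreasing_diagonal :: "real^('n::{finite,linorder})^('n::{finite,linorder}) \<Rightarrow> bool" where
  "decreasing_diagonal D \<longleftrightarrow> (\<forall>i j. i \<le> j \<longrightarrow> D $ i $ i \<ge> D $ j $ j)"

definition global_minimizer :: "(real^'n \<Rightarrow> real) \<Rightarrow> real^'n \<Rightarrow> bool" where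
  "global_minimizer f y \<longleftrightarrow> is_arg_min f (\<lambda>z. z \<in> UNIV) y"

end

theory Submission
  imports Defs
begin

text \<open>
  Expanding the objective gives the quartic
  \<open>f y = (y \<bullet> y)\<^sup>2 / 4 - y \<bullet> D y / 2 + b \<bullet> y + c\<close>. Because \<open>D\<close> is symmetric, with
  \<open>G = (y \<bullet> y) y - D y + b\<close> one has the exact identity
  \<open>f z - f y = G \<bullet> (z - y) + (z \<bullet> z - y \<bullet> y)\<^sup>2 / 4
    + (z - y) \<bullet> ((y \<bullet> y) I - D) (z - y) / 2\<close>.
  If \<open>G = 0\<close> and \<open>y \<bullet> y\<close> is at least the largest eigenvalue of \<open>D\<close>, the right-hand side is
  nonnegative. Conversely, when \<open>y\<close> is a global minimizer and \<open>e\<close> is a top eigenvector,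
  reflecting \<open>y\<close> in the hyperplane orthogonal to \<open>e\<close> keeps the norm, so that only the
  quadratic form survives, and its sign forces \<open>y \<bullet> y \<ge> D\<^sub>1\<^sub>1\<close>; if \<open>y\<close> lies in that
  hyperplane, moving along \<open>e\<close> does the same.
\<close>

definition quartic :: "real^'n^'n \<Rightarrow> real^'n \<Rightarrow> real \<Rightarrow> real^'n \<Rightarrow> real" where
  "quartic D b c z = (z \<bullet> z)\<^sup>2 / 4 - z \<bullet> (D *v z) / 2 + b \<bullet> z + c"

text \<open>Kept as an algebraic formula so that the expansion is free of calculus;
  \<open>quartic_GDERIV\<close> links it to the derivative for symmetric \<open>D\<close>.\<close>

definition quartic_gradient :: "real^'n^'n \<Rightarrow> real^'n \<Rightarrow> real^'n \<Rightarrow> real^'n" where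
  "quartic_gradient D b y = (y \<bullet> y) *\<^sub>R y - D *v y + b"

section \<open>The localization objective as a quartic\<close>

lemma outer_product_mult_vec: "outer_product u v *v x = (v \<bullet> x) *\<^sub>R u"
  by (simp add: vec_eq_iff outer_product_def matrix_vector_mult_def inner_vec_def
      sum_distrib_left sum_distrib_right mult_ac)

lemma sum_matrix_vector_mult:
  fixes A :: "'i \<Rightarrow> real^'n^'m"
  shows "(\<Sum>i\<in>I. A i) *v x = (\<Sum>i\<in>I. A i *v x)"
  by (induction I rule: infinite_finite_induct) (simp_all add: matrix_vector_mult_add_rdistrib)

lemma uminus_matrix_vector_mult:
  fixes A :: "real^'n^'m"
  shows "(- A) *v x = - (A *v x)"
  by (simp add: vec_eq_iff matrix_vector_mult_def sum_negf)

lemma localization_matrix_mult_vec: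
  "localization_matrix W s d *v x = - (\<Sum>i\<in>UNIV. \<Sum>j\<in>UNIV. W $ i $ j *\<^sub>R
      (2 *\<^sub>R (s i \<bullet> x) *\<^sub>R s j + (s i \<bullet> s i - (d i)\<^sup>2) *\<^sub>R x))"
  by (simp only: localization_matrix_def uminus_matrix_vector_mult sum_matrix_vector_mult
      scaleR_matrix_vector_assoc[symmetric] matrix_vector_mult_add_rdistrib
      outer_product_mult_vec matrix_vector_mul_lid)

lemma localization_matrix_quadratic_form:
  fixes s :: "'m::finite \<Rightarrow> real^'n"
  shows "x \<bullet> (localization_matrix W s d *v x) =
    - (\<Sum>i\<in>UNIV. \<Sum>j\<in>UNIV. W $ i $ j *
        (2 * (x \<bullet> s i) * (x \<bullet> s j) + (s i \<bullet> s i - (d i)\<^sup>2) * (x \<bullet> x)))"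
  by (simp only: localization_matrix_mult_vec inner_commute[of "s _" x] inner_minus_right
      inner_sum_right inner_scaleR_right inner_add_right mult.assoc)

text \<open>Each factor is \<open>X - 2 * (x \<bullet> s i) + p i\<close>. The normalization makes
  the leading part \<open>X\<^sup>2\<close> and kills the terms
  \<open>X * (x \<bullet> s i)\<close>; the remaining quadratic terms are -2 times the form of the
  localization matrix.\<close>

lemma localization_objective_quartic:
  fixes W :: "real^'m^'m" and s :: "'m \<Rightarrow> real^'n"
  assumes sym: "transpose W = W"
    and one: "(\<Sum>i\<in>UNIV. \<Sum>j\<in>UNIV. W $ i $ j) = 1"
    and zero: "(\<Sum>i\<in>UNIV. \<Sum>j\<in>UNIV. W $ i $ j *\<^sub>R s i) = 0"
  obtains g c where "\<And>x. localization_objective W s d x = quartic (localization_matrix W s d) g c x"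
proof
  define p where "p i = s i \<bullet> s i - (d i)\<^sup>2" for i
  \<comment> \<open>This functional is linear and, by symmetry of \<open>W\<close>, blind to
    swapping the indices, so the computation happens on integrands.\<close>
  define S :: "('m \<Rightarrow> 'm \<Rightarrow> real) \<Rightarrow> real"
    where "S F = (\<Sum>i\<in>UNIV. \<Sum>j\<in>UNIV. W $ i $ j * F i j)" for F
  have S_add: "S (\<lambda>i j. F i j + G i j) = S F + S G" for F G
    by (simp add: S_def distrib_left sum.distrib)
  have S_mult: "S (\<lambda>i j. a * F i j) = a * S F" for a F
    by (simp add: S_def sum_distrib_left mult_ac)
  have W_sym: "W $ i $ j = W $ j $ i" for i j
    using sym by (metis transpose_def vec_lambda_beta)
  have S_swap: "S (\<lambda>i j. F j i) = S F" for F
    unfolding S_def by (subst sum.swap) (simp add: W_sym)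
  have S_one: "S (\<lambda>i j. 1) = 1"
    using one by (simp add: S_def)
  have S_lin: "S (\<lambda>i j. x \<bullet> s i) = 0" for x
    using arg_cong[OF zero, of "\<lambda>v. x \<bullet> v"] by (simp add: S_def inner_sum_right)
  fix x :: "real^'n"
  define X where "X = x \<bullet> x"
  have "4 * localization_objective W s d x
      = S (\<lambda>i j. (X - 2 * (x \<bullet> s i) + p i) * (X - 2 * (x \<bullet> s j) + p j))"
    by (simp add: localization_objective_def S_def p_def X_def power2_norm_eq_inner
        inner_diff_left inner_diff_right inner_commute algebra_simps)
  \<comment> \<open>Right-nested, with scalars in front and an explicit factor 1, so that linearity
    alone splits the sum.\<close>
  also have "\<dots> = S (\<lambda>i j. X\<^sup>2 * 1 + ((- 2 * X) * (x \<bullet> s i) + ((- 2 * X) * (x \<bullet> s j) + (X * p i +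
      (X * p j + (p i * p j + ((- 2) * (p i * (x \<bullet> s j)) + ((- 2) * (p j * (x \<bullet> s i)) +
      4 * ((x \<bullet> s i) * (x \<bullet> s j))))))))))"
    by (simp add: algebra_simps power2_eq_square)
  also have "\<dots> = X\<^sup>2 + 2 * X * S (\<lambda>i j. p i) + S (\<lambda>i j. p i * p j)
      - 4 * S (\<lambda>i j. p i * (x \<bullet> s j)) + 4 * S (\<lambda>i j. (x \<bullet> s i) * (x \<bullet> s j))"
    using S_swap[of "\<lambda>i j. x \<bullet> s i"] S_swap[of "\<lambda>i j. p i"]
      S_swap[of "\<lambda>i j. p i * (x \<bullet> s j)"]
    by (simp only: S_add S_mult S_one S_lin)
  finally have obj: "4 * localization_objective W s d x = \<dots>" .
  have "x \<bullet> (localization_matrix W s d *v x)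
      = - S (\<lambda>i j. 2 * ((x \<bullet> s i) * (x \<bullet> s j)) + X * p i)"
    by (simp add: localization_matrix_quadratic_form S_def p_def X_def mult_ac)
  also have "\<dots> = - 2 * S (\<lambda>i j. (x \<bullet> s i) * (x \<bullet> s j)) - X * S (\<lambda>i j. p i)"
    by (simp only: S_add S_mult)
  finally have form: "x \<bullet> (localization_matrix W s d *v x) = \<dots>" .
  have lin: "(- (\<Sum>i\<in>UNIV. \<Sum>j\<in>UNIV. (W $ i $ j * p i) *\<^sub>R s j)) \<bullet> x = - S (\<lambda>i j. p i * (x \<bullet> s j))"
    by (simp add: S_def inner_sum_right inner_commute[of _ x] mult_ac)
  show "localization_objective W s d x = quartic (localization_matrix W s d)
      (- (\<Sum>i\<in>UNIV. \<Sum>j\<in>UNIV. (W $ i $ j * p i) *\<^sub>R s j)) (S (\<lambda>i j. p i * p j) / 4) x"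
    unfolding quartic_def form lin using obj by (simp add: X_def field_simps)
qed

text \<open>An orthogonal \<open>Q\<close> preserves \<open>z \<bullet> z\<close>, so only the
  matrix and the linear coefficient are transformed.\<close>

lemma quartic_orthogonal_change:
  assumes "orthogonal_matrix Q"
  shows "quartic A g c (Q *v z) = quartic (transpose Q ** A ** Q) (transpose Q *v g) c z"
proof -
  have adj: "(Q *v z) \<bullet> w = z \<bullet> (transpose Q *v w)" for w
    by (metis dot_lmul_matrix vector_transpose_matrix)
  have "transpose Q *v (Q *v z) = z"
    using assms by (simp add: orthogonal_matrix_def matrix_vector_mul_assoc)
  then have "(Q *v z) \<bullet> (Q *v z) = z \<bullet> z"
    by (simp add: adj)
  moreover have "(Q *v z) \<bullet> (A *v (Q *v z)) = z \<bullet> ((transpose Q ** A ** Q) *v z)"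
    by (simp add: adj matrix_vector_mul_assoc matrix_mul_assoc)
  moreover have "g \<bullet> (Q *v z) = (transpose Q *v g) \<bullet> z"
    by (metis adj inner_commute)
  ultimately show ?thesis
    by (simp add: quartic_def)
qed

section \<open>Exact expansion and gradient of the quartic\<close>

lemma symmetric_matrix_inner:
  fixes D :: "real^'n^'n"
  assumes "transpose D = D"
  shows "u \<bullet> (D *v v) = v \<bullet> (D *v u)"
  by (subst inner_commute) (metis assms dot_lmul_matrix vector_transpose_matrix)

text \<open>The squared norm grows by \<open>2 * (y \<bullet> v) + v \<bullet> v\<close>; in the
  squared norm's square, the cross term of this increment with \<open>y \<bullet> y\<close> splits
  between the gradient part and the quadratic form.\<close>

lemma quartic_diff:
  assumes "transpose D = D"
  shows "quartic D b c (y + v) - quartic D b c y = quartic_gradient D b y \<bullet> v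
    + (2 * (y \<bullet> v) + v \<bullet> v)\<^sup>2 / 4 + ((y \<bullet> y) * (v \<bullet> v) - v \<bullet> (D *v v)) / 2"
proof -
  have swap: "(D *v y) \<bullet> v = y \<bullet> (D *v v)" "v \<bullet> (D *v y) = y \<bullet> (D *v v)"
    using symmetric_matrix_inner[OF assms, of v y] by (simp_all add: inner_commute)
  have square: "(y + v) \<bullet> (y + v) = y \<bullet> y + (2 * (y \<bullet> v) + v \<bullet> v)"
    by (simp add: inner_add_left inner_add_right inner_commute[of v y])
  have form: "(y + v) \<bullet> (D *v (y + v)) = y \<bullet> (D *v y) + 2 * (y \<bullet> (D *v v)) + v \<bullet> (D *v v)"
    by (simp add: matrix_vector_right_distrib inner_add_left inner_add_right swap)
  have lin: "quartic_gradient D b y \<bullet> v = (y \<bullet> y) * (y \<bullet> v) - y \<bullet> (D *v v) + b \<bullet> v"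
    by (simp add: quartic_gradient_def inner_add_left inner_diff_left swap)
  show ?thesis
    unfolding quartic_def square form lin inner_add_right[of b]
    by (simp add: power2_eq_square field_simps)
qed

lemma quartic_GDERIV:
  assumes "transpose D = D"
  shows "GDERIV (quartic D b c) y :> quartic_gradient D b y"
proof -
  \<comment> \<open>Symmetry merges the two product-rule terms of the quadratic form.\<close>
  have swap: "y \<bullet> (D *v h) = (D *v y) \<bullet> h" "h \<bullet> (D *v y) = (D *v y) \<bullet> h" for h
    using symmetric_matrix_inner[OF assms, of h y] by (simp_all add: inner_commute)
  have D: "((*v) D has_derivative (*v) D) (at y)"
    by (intro bounded_linear_imp_has_derivative matrix_vector_mul_bounded_linear)
  have square: "((\<lambda>z. z \<bullet> z) has_derivative (\<lambda>h. 2 * (y \<bullet> h))) (at y)"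
    using has_derivative_inner[OF has_derivative_ident has_derivative_ident, of y UNIV]
    by (simp add: inner_commute[of _ y])
  have form: "((\<lambda>z. z \<bullet> (D *v z)) has_derivative (\<lambda>h. 2 * ((D *v y) \<bullet> h))) (at y)"
    using has_derivative_inner[OF has_derivative_ident D] by (simp add: swap)
  have lin: "((\<bullet>) b has_derivative (\<bullet>) b) (at y)"
    by (intro bounded_linear_imp_has_derivative bounded_linear_inner_right)
  have "(quartic D b c has_derivative
      (\<lambda>h. (4 * (y \<bullet> y) * (y \<bullet> h)) / 4 - 2 * ((D *v y) \<bullet> h) / 2 + b \<bullet> h + 0)) (at y)"
    unfolding quartic_def[abs_def]
    by (intro has_derivative_add has_derivative_diff has_derivative_const lin
        bounded_linear.has_derivative[OF bounded_linear_divide] form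
        has_derivative_eq_rhs[OF has_derivative_power[OF square]]) auto
  also have "(\<lambda>h. (4 * (y \<bullet> y) * (y \<bullet> h)) / 4 - 2 * ((D *v y) \<bullet> h) / 2 + b \<bullet> h + 0)
      = (\<lambda>h. h \<bullet> quartic_gradient D b y)"
    by (simp add: fun_eq_iff inner_commute[of _ "quartic_gradient D b y"])
      (simp add: quartic_gradient_def inner_add_left inner_diff_left)
  finally show ?thesis
    by (simp add: gderiv_def)
qed

text \<open>Derivatives are unique, so criticality becomes a vector equation.\<close>

lemma quartic_GDERIV_zero_iff:
  assumes "transpose D = D"
  shows "(GDERIV (quartic D b c) y :> 0) \<longleftrightarrow> quartic_gradient D b y = 0"
proof
  assume "GDERIV (quartic D b c) y :> 0"
  then have "(\<lambda>h. h \<bullet> 0) = (\<lambda>h. h \<bullet> quartic_gradient D b y)"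
    using quartic_GDERIV[OF assms, of b c y] unfolding gderiv_def by (rule has_derivative_unique)
  then show "quartic_gradient D b y = 0"
    by (metis inner_eq_zero_iff inner_zero_right)
next
  assume "quartic_gradient D b y = 0"
  then show "GDERIV (quartic D b c) y :> 0"
    using quartic_GDERIV[OF assms, of b c y] by simp
qed

lemma global_minimizer_iff: "global_minimizer f y \<longleftrightarrow> (\<forall>z. f y \<le> f z)"
  by (auto simp: global_minimizer_def is_arg_min_linorder)

section \<open>Diagonal matrices with decreasing entries\<close>

lemma diagonal_matrix_mult_vec:
  assumes "diagonal_matrix D"
  shows "(D *v v) $ i = D $ i $ i * v $ i"
proof -
  have "(D *v v) $ i = (\<Sum>j\<in>UNIV. if j = i then D $ i $ i * v $ i else 0)"
    unfolding matrix_vector_mult_def vec_lambda_beta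
    using assms by (intro sum.cong) (auto simp: diagonal_matrix_def)
  then show ?thesis by simp
qed

lemma diagonal_matrix_transpose:
  assumes "diagonal_matrix D"
  shows "transpose D = D"
  using assms unfolding diagonal_matrix_def transpose_def
  by (simp add: vec_eq_iff) metis

lemma decreasing_diagonal_quadratic_form_le:
  assumes "diagonal_matrix D" "decreasing_diagonal D"
  shows "v \<bullet> (D *v v) \<le> D $ first_index $ first_index * (v \<bullet> v)"
proof -
  have "D $ i $ i \<le> D $ first_index $ first_index" for i
    using assms(2) by (simp add: decreasing_diagonal_def first_index_def)
  then have "D $ i $ i * (v $ i * v $ i) \<le> D $ first_index $ first_index * (v $ i * v $ i)" for i
    by (intro mult_right_mono) auto
  then show ?thesis
    by (auto simp: inner_vec_def diagonal_matrix_mult_vec[OF assms(1)] sum_distrib_left mult_ac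
        intro!: sum_mono)
qed

section \<open>Necessary conditions at a global minimizer\<close>

lemma quartic_global_minimizer_gradient:
  assumes "transpose D = D" "global_minimizer (quartic D b c) y"
  shows "quartic_gradient D b y = 0"
proof -
  \<comment> \<open>Fermat's rule; evaluating at \<open>h\<close> equal to the gradient then gives
    zero squared norm.\<close>
  have "(\<lambda>h. h \<bullet> quartic_gradient D b y) = (\<lambda>h. 0)"
    using quartic_GDERIV[OF assms(1), of b c y] assms(2)
    unfolding gderiv_def global_minimizer_iff
    by (intro differential_zero_maxmin[of y UNIV "quartic D b c"]) auto
  then show ?thesis
    by (metis inner_eq_zero_iff)
qed

lemma quartic_global_minimizer_eigenvalue_le:
  assumes sym: "transpose D = D" and min: "global_minimizer (quartic D b c) y"
    and eig: "D *v e = \<mu> *\<^sub>R e" and unit: "e \<bullet> e = 1"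
  shows "\<mu> \<le> y \<bullet> y"
proof (rule ccontr)
  define r where "r = \<mu> - y \<bullet> y"
  assume "\<not> \<mu> \<le> y \<bullet> y"
  then have r: "r > 0" by (simp add: r_def)
  \<comment> \<open>Optimality on the line \<open>y + t *\<^sub>R e\<close>: the gradient term of
    \<open>quartic_diff\<close> vanishes.\<close>
  have along: "0 \<le> (2 * t * (y \<bullet> e) + t\<^sup>2)\<^sup>2 / 4 - r * t\<^sup>2 / 2" for t
  proof -
    have "0 \<le> quartic D b c (y + t *\<^sub>R e) - quartic D b c y"
      using min by (simp add: global_minimizer_iff)
    also have "\<dots> = (2 * t * (y \<bullet> e) + t\<^sup>2)\<^sup>2 / 4 - r * t\<^sup>2 / 2"
      unfolding quartic_diff[OF sym] quartic_global_minimizer_gradient[OF sym min]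
      by (simp add: matrix_vector_mult_scaleR eig unit r_def power2_eq_square algebra_simps
          diff_divide_distrib)
    finally show ?thesis .
  qed
  show False
  proof (cases "y \<bullet> e = 0")
    case True
    \<comment> \<open>The bound reads \<open>t^4 / 4 - r * t\<^sup>2 / 2\<close>, which is smallest
      at \<open>t = sqrt r\<close>, with value \<open>- r\<^sup>2 / 4\<close>.\<close>
    have "0 \<le> r\<^sup>2 / 4 - r * r / 2"
      using along[of "sqrt r"] True r by simp
    moreover have "r * r > 0"
      using r by simp
    ultimately show False
      by (simp add: power2_eq_square)
  next
    case False
    \<comment> \<open>This \<open>t\<close> is the reflection: it makes
      \<open>2 * t * (y \<bullet> e) + t\<^sup>2\<close> zero.\<close>
    have "0 \<le> - (r * (2 * (y \<bullet> e))\<^sup>2 / 2)"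
      using along[of "- 2 * (y \<bullet> e)"] by (simp add: power2_eq_square)
    moreover have "r * (2 * (y \<bullet> e))\<^sup>2 > 0"
      using r False by simp
    ultimately show False by linarith
  qed
qed

theorem mainTheorem3:
  fixes W :: "real^'m^'m"
    and s :: "'m \<Rightarrow> real^('n::{finite,linorder})"
    and d :: "'m \<Rightarrow> real"
    and Q D :: "real^('n::{finite,linorder})^('n::{finite,linorder})"
    and f :: "real^('n::{finite,linorder}) \<Rightarrow> real"
    and y :: "real^('n::{finite,linorder})"
  assumes "positive_definite W"
    and "(\<Sum>i\<in>UNIV. \<Sum>j\<in>UNIV. W $ i $ j) = 1"
    and "(\<Sum>i\<in>UNIV. \<Sum>j\<in>UNIV. W $ i $ j *\<^sub>R s i) = 0"
    and "orthogonal_matrix Q"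
    and "D = transpose Q ** localization_matrix W s d ** Q"
    and "diagonal_matrix D"
    and "decreasing_diagonal D"
    and "f = (\<lambda>z. localization_objective W s d (Q *v z))"
  shows "(global_minimizer f y \<longleftrightarrow>
            (GDERIV f y :> 0) \<and> y \<bullet> y \<ge> D $ first_index $ first_index) \<and>
         ((GDERIV f y :> 0) \<and> y \<bullet> y > D $ first_index $ first_index \<longrightarrow>
            global_minimizer f y \<and> (\<forall>z. global_minimizer f z \<longrightarrow> z = y))"
proof -
  let ?m = "D $ first_index $ first_index"
  have sym: "transpose D = D"
    using assms(6) by (rule diagonal_matrix_transpose)
  obtain g c where "\<And>x. localization_objective W s d x = quartic (localization_matrix W s d) g c x"
    using assms(1) localization_objective_quartic[OF _ assms(2,3)]
    unfolding positive_definite_def by blast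
  then obtain b where f: "f = quartic D b c"
    using assms(8) quartic_orthogonal_change[OF assms(4)] by (auto simp: assms(5))
  \<comment> \<open>Dropping the square and bounding the form by the top eigenvalue leaves a
    quadratic growth bound: a nonnegative factor yields minimality, a positive one
    uniqueness.\<close>
  have gap: "f z - f y \<ge> (y \<bullet> y - ?m) * ((z - y) \<bullet> (z - y)) / 2" if "GDERIV f y :> 0" for z
  proof -
    have "quartic_gradient D b y = 0"
      using that quartic_GDERIV_zero_iff[OF sym] by (simp add: f)
    then have "f z - f y = (2 * (y \<bullet> (z - y)) + (z - y) \<bullet> (z - y))\<^sup>2 / 4
        + ((y \<bullet> y) * ((z - y) \<bullet> (z - y)) - (z - y) \<bullet> (D *v (z - y))) / 2"
      using quartic_diff[OF sym, of b c y "z - y"] by (simp add: f)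
    also have "\<dots> \<ge> 0 + ((y \<bullet> y) * ((z - y) \<bullet> (z - y)) - ?m * ((z - y) \<bullet> (z - y))) / 2"
      by (intro add_mono divide_right_mono diff_left_mono
          decreasing_diagonal_quadratic_form_le[OF assms(6,7)]) simp_all
    finally show ?thesis
      by (simp add: left_diff_distrib)
  qed
  have suff: "global_minimizer f y" if "GDERIV f y :> 0" "?m \<le> y \<bullet> y"
    unfolding global_minimizer_iff
  proof
    fix z
    have "0 \<le> (y \<bullet> y - ?m) * ((z - y) \<bullet> (z - y)) / 2"
      using that(2) by simp
    then show "f y \<le> f z"
      using gap[OF that(1), of z] by linarith
  qed
  have nec: "(GDERIV f y :> 0) \<and> ?m \<le> y \<bullet> y" if min: "global_minimizer f y"
  proof
    show "GDERIV f y :> 0"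
      using min quartic_global_minimizer_gradient[OF sym] quartic_GDERIV_zero_iff[OF sym]
      by (simp add: f)
    \<comment> \<open>The first coordinate vector is a unit eigenvector for the largest diagonal
      entry.\<close>
    have "D *v axis first_index 1 = ?m *\<^sub>R axis first_index 1"
      by (simp add: vec_eq_iff diagonal_matrix_mult_vec[OF assms(6)] axis_def)
    then show "?m \<le> y \<bullet> y"
      by (rule quartic_global_minimizer_eigenvalue_le[OF sym min[unfolded f]])
        (simp add: inner_axis_axis)
  qed
  have uniq: "z = y" if "GDERIV f y :> 0" "?m < y \<bullet> y" "global_minimizer f z" for z
  proof (rule ccontr)
    assume "z \<noteq> y"
    then have "0 < (y \<bullet> y - ?m) * ((z - y) \<bullet> (z - y)) / 2"
      using that(2) by simp
    moreover have "f z \<le> f y"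
      using that(3) by (simp add: global_minimizer_iff)
    ultimately show False
      using gap[OF that(1), of z] by linarith
  qed
  show ?thesis
    using suff nec uniq by (meson less_imp_le)
qed

end
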